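(* Given an order-$k$ collapsible alternating pushdown tree automaton $\mathcal{A}$ on $(AP,X\times Y)$-trees, one can build an order-$k$ collapsible alternating pushdown tree automaton $\mathcal{A}_{\Downarrow X}$ on $(AP,X)$-trees such that for every pointed $(AP,X)$-tree $(T,u)$, every $u'\in(X\times Y)^+$ whose projection on $X$ is $u$, and every initial $k$-stack $w_\iota\in\mathrm{Stacks}_k$, $(T,u)\in L(\mathcal{A}_{\Downarrow X},w_\iota)$ if and only if $(T^{\Uparrow X\times Y},u')\in L(\mathcal{A},w_\iota)$, where $T^{\Uparrow X\times Y}$ is the $Y$-widening of $T$ rooted in the first letter of $u'$.
   Context: Trees: a $D$-tree is a set of words in $D^+$ with a common root letter, closed under nonempty prefixes, every node having a child; an $(AP,D)$-tree is $(\tau,\ell)$ with $\ell:\tau\to 2^{AP}$. The projection on $X$ of $(x,y)$ is $x$, extended letterwise. For an $X$-tree $\tau$ with root $x$ and $y\in Y$, its $Y$-widening rooted in $(x,y)$ is $\{v\in(x,y)(X\times Y)^*:\text{projection of }v\text{ on }X\in\tau\}$, labelled by $\ell'(v)=\ell(\text{projection of }v)$. Higher-order stacks: order-1 stacks with links are words $\bot a_1\dots a_\ell$ with $a_i\in\Gamma$ or $a_i=(a,j,h)\in\Gamma\times\{2..k\}\times\mathbb{N}$; order-$j$ stacks are nonempty sequences of order-$(j-1)$ stacks; $\mathrm{Stacks}_k$ is the set of order-$k$ stacks; $\mathrm{op}_k(\Gamma)$ consists of $\mathrm{pop}_i$, $\mathrm{push}_i$, $\mathrm{push}_1^a$, $\mathrm{push}_1^{a,\ell}$,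 $\mathrm{collapse}$ (standard higher-order/collapsible stack operations). An order-$k$ collapsible alternating pushdown tree automaton (CAPTA) on $(AP,D)$-trees is $(\Gamma,Q,\delta,q_\iota,C)$ with $\delta:Q\times2^{AP}\times\Gamma\to B^+(D\times Q\times\mathrm{op}_k(\Gamma))$ (positive Boolean formulas with $\mathit{true},\mathit{false}$) and $C:Q\to\mathbb{N}$. Acceptance of a pointed tree $(T,u)$ from initial stack $w_\iota$ is via the parity game with positions (node, state, stack, formula) starting at $(u,q_\iota,w_\iota,\delta(q_\iota,\ell(u),\text{top symbol of }w_\iota))$, where Eve resolves disjunctions, Adam conjunctions, and atom $[x,q',op]$ moves to child $vx$, state $q'$, stack $op(\text{stack})$ and formula $\delta(q',\ell(vx),\text{new top symbol})$; $\mathit{true}$/$\mathit{false}$ are won by Eve/Adam; infinite plays are won by Eve iff the largest colour seen infinitely often is even. $L(\mathcal{A},w_\iota)$ is the set of pointed trees won by Eve. *)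

theory Defs
  imports Main
begin

section \<open>Trees\<close>

definition is_tree :: "'d set \<Rightarrow> 'd list set \<Rightarrow> bool" where
  "is_tree D \<tau> \<longleftrightarrow>
     \<tau> \<noteq> {} \<and> [] \<notin> \<tau> \<and> \<tau> \<subseteq> lists D \<and>
     (\<exists>r. \<forall>u\<in>\<tau>. hd u = r) \<and>
     (\<forall>u v. u @ v \<in> \<tau> \<and> u \<noteq> [] \<longrightarrow> u \<in> \<tau>) \<and>
     (\<forall>u\<in>\<tau>. \<exists>x. u @ [x] \<in> \<tau>)"

text \<open>The values of the labelling outside the set of nodes are irrelevant.\<close>

type_synonym ('ap, 'd) ltree = "'d list set \<times> ('d list \<Rightarrow> 'ap set)"

definition is_ltree :: "'ap set \<Rightarrow> 'd set \<Rightarrow> ('ap, 'd) ltree \<Rightarrow> bool" where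
  "is_ltree AP D T \<longleftrightarrow> is_tree D (fst T) \<and> (\<forall>u\<in>fst T. snd T u \<subseteq> AP)"

definition is_pointed_tree :: "'ap set \<Rightarrow> 'd set \<Rightarrow> ('ap, 'd) ltree \<Rightarrow> 'd list \<Rightarrow> bool" where
  "is_pointed_tree AP D T u \<longleftrightarrow> is_ltree AP D T \<and> u \<in> fst T"

definition proj :: "('x \<times> 'y) list \<Rightarrow> 'x list" where
  "proj v = map fst v"

definition widening ::
    "'x set \<Rightarrow> 'y set \<Rightarrow> 'x \<times> 'y \<Rightarrow> ('ap, 'x) ltree \<Rightarrow> ('ap, 'x \<times> 'y) ltree" where
  "widening X Y r T =
     ({r # w |w. w \<in> lists (X \<times> Y) \<and> proj (r # w) \<in> fst T}, \<lambda>v. snd T (proj v))"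

section \<open>Collapsible higher-order stacks\<close>

text \<open>
  The bottom symbol is not an element of the stack alphabet. The letter \<open>Linked a j h\<close> carries a
  link of order \<open>j\<close>: it points to the \<open>h\<close>-th order-\<open>(j-1)\<close> stack, counted from the bottom and
  starting with 1, of the order-\<open>j\<close> stack that contains the letter. As links are absolute
  heights, duplicating a stack does not change them. The value \<open>h = 0\<close> is a dangling link.
\<close>

datatype 'g letter = Bot | Plain 'g | Linked 'g nat nat

text \<open>Sequences are listed from bottom to top, so the top is the last element.\<close>

datatype 'g stack = Letter "'g letter" | Seq "'g stack list"

definition letters :: "'g set \<Rightarrow> nat \<Rightarrow> 'g letter set" where
  "letters \<Gamma> k = Plain ` \<Gamma> \<union> {Linked a j h |a j h. a \<in> \<Gamma> \<and> j \<in> {2..k}}"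

fun stacks_of_order :: "'g set \<Rightarrow> nat \<Rightarrow> nat \<Rightarrow> 'g stack set" where
  "stacks_of_order \<Gamma> k 0 = {}"
| "stacks_of_order \<Gamma> k (Suc 0) =
     {Seq (Letter Bot # map Letter as) |as. as \<in> lists (letters \<Gamma> k)}"
| "stacks_of_order \<Gamma> k (Suc (Suc j)) =
     {Seq ss |ss. ss \<noteq> [] \<and> ss \<in> lists (stacks_of_order \<Gamma> k (Suc j))}"

definition Stacks :: "nat \<Rightarrow> 'g set \<Rightarrow> 'g stack set" where
  "Stacks k \<Gamma> = stacks_of_order \<Gamma> k k"

text \<open>
  The topmost order-\<open>i\<close> stack of an order-\<open>k\<close> stack lies at depth \<open>k - i\<close>; the topmost letter
  is the case \<open>i = 0\<close>.
\<close>

primrec top_at :: "nat \<Rightarrow> 'g stack \<Rightarrow> 'g stack" where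
  "top_at 0 s = s"
| "top_at (Suc d) s = (case s of Letter a \<Rightarrow> s | Seq ss \<Rightarrow> top_at d (last ss))"

definition top_letter :: "nat \<Rightarrow> 'g stack \<Rightarrow> 'g letter" where
  "top_letter k s = (case top_at k s of Letter a \<Rightarrow> a | Seq ss \<Rightarrow> Bot)"

text \<open>\<open>None\<close> stands for the bottom symbol; links are not visible.\<close>

definition top_symbol :: "nat \<Rightarrow> 'g stack \<Rightarrow> 'g option" where
  "top_symbol k s =
     (case top_letter k s of Bot \<Rightarrow> None | Plain a \<Rightarrow> Some a | Linked a j h \<Rightarrow> Some a)"

primrec height :: "'g stack \<Rightarrow> nat" where
  "height (Letter a) = 0"
| "height (Seq ss) = length ss"

text \<open>Applies a partial operation to the topmost stack at the given depth; \<open>None\<close> is undefined.\<close>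

primrec update_at ::
    "nat \<Rightarrow> ('g stack list \<Rightarrow> 'g stack list option) \<Rightarrow> 'g stack \<Rightarrow> 'g stack option" where
  "update_at 0 f s = (case s of Letter a \<Rightarrow> None | Seq ss \<Rightarrow> map_option Seq (f ss))"
| "update_at (Suc d) f s =
     (case s of Letter a \<Rightarrow> None
      | Seq ss \<Rightarrow> map_option (\<lambda>t. Seq (butlast ss @ [t])) (update_at d f (last ss)))"

datatype 'g stack_op =
  Pop nat | Push nat | Push1 'g | Push1Link 'g nat | Collapse

definition stack_ops :: "nat \<Rightarrow> 'g set \<Rightarrow> 'g stack_op set" where
  "stack_ops k \<Gamma> =
     Pop ` {1..k} \<union> Push ` {2..k} \<union> Push1 ` \<Gamma> \<union>
     {Push1Link a l |a l. a \<in> \<Gamma> \<and> l \<in> {2..k}} \<union> {Collapse}"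

text \<open>
  A pop is undefined if it would empty the stack it acts on (so the bottom symbol is never
  removed). A new link of order \<open>l\<close> points to the order-\<open>(l-1)\<close> stack just below the topmost one.
  Collapsing removes everything above the target of the topmost link; it is undefined if there is
  no link or if its target does not lie below the topmost letter.
\<close>

fun apply_op :: "nat \<Rightarrow> 'g stack_op \<Rightarrow> 'g stack \<Rightarrow> 'g stack option" where
  "apply_op k (Pop i) s =
     update_at (k - i) (\<lambda>ss. if length ss \<ge> 2 then Some (butlast ss) else None) s"
| "apply_op k (Push i) s = update_at (k - i) (\<lambda>ss. Some (ss @ [last ss])) s"
| "apply_op k (Push1 a) s = update_at (k - 1) (\<lambda>ss. Some (ss @ [Letter (Plain a)])) s"
| "apply_op k (Push1Link a l) s =
     update_at (k - 1)
       (\<lambda>ss. Some (ss @ [Letter (Linked a l (height (top_at (k - l) s) - 1))])) s"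
| "apply_op k Collapse s =
     (case top_letter k s of
        Linked a j h \<Rightarrow>
          update_at (k - j) (\<lambda>ss. if 0 < h \<and> h < length ss then Some (take h ss) else None) s
      | _ \<Rightarrow> None)"

section \<open>Parity games\<close>

record 'v parity_game =
  eve_pos :: "'v set"
  moves :: "('v \<times> 'v) set"
  pos_colour :: "'v \<Rightarrow> nat"

definition dead_end :: "('v, 'b) parity_game_scheme \<Rightarrow> 'v \<Rightarrow> bool" where
  "dead_end G v \<longleftrightarrow> (\<nexists>v'. (v, v') \<in> moves G)"

definition finite_play :: "('v, 'b) parity_game_scheme \<Rightarrow> 'v \<Rightarrow> 'v list \<Rightarrow> bool" where
  "finite_play G v h \<longleftrightarrow>
     h \<noteq> [] \<and> hd h = v \<and> (\<forall>i. Suc i < length h \<longrightarrow> (h ! i, h ! Suc i) \<in> moves G)"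

definition infinite_play :: "('v, 'b) parity_game_scheme \<Rightarrow> 'v \<Rightarrow> (nat \<Rightarrow> 'v) \<Rightarrow> bool" where
  "infinite_play G v p \<longleftrightarrow> p 0 = v \<and> (\<forall>i. (p i, p (Suc i)) \<in> moves G)"

text \<open>A strategy for Eve maps the history of the play to the next position.\<close>

definition eve_strategy ::
    "('v, 'b) parity_game_scheme \<Rightarrow> 'v \<Rightarrow> ('v list \<Rightarrow> 'v) \<Rightarrow> bool" where
  "eve_strategy G v \<sigma> \<longleftrightarrow>
     (\<forall>h. finite_play G v h \<and> last h \<in> eve_pos G \<and> \<not> dead_end G (last h)
        \<longrightarrow> (last h, \<sigma> h) \<in> moves G)"

definition finite_conform ::
    "('v, 'b) parity_game_scheme \<Rightarrow> ('v list \<Rightarrow> 'v) \<Rightarrow> 'v list \<Rightarrow> bool" where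
  "finite_conform G \<sigma> h \<longleftrightarrow>
     (\<forall>i. Suc i < length h \<and> h ! i \<in> eve_pos G \<longrightarrow> h ! Suc i = \<sigma> (take (Suc i) h))"

definition infinite_conform ::
    "('v, 'b) parity_game_scheme \<Rightarrow> ('v list \<Rightarrow> 'v) \<Rightarrow> (nat \<Rightarrow> 'v) \<Rightarrow> bool" where
  "infinite_conform G \<sigma> p \<longleftrightarrow>
     (\<forall>i. p i \<in> eve_pos G \<longrightarrow> p (Suc i) = \<sigma> (map p [0..<Suc i]))"

definition parity_condition :: "('v, 'b) parity_game_scheme \<Rightarrow> (nat \<Rightarrow> 'v) \<Rightarrow> bool" where
  "parity_condition G p \<longleftrightarrow>
     (\<exists>c. infinite {n. pos_colour G (p n) = c} \<and>
          (\<forall>c'. infinite {n. pos_colour G (p n) = c'} \<longrightarrow> c' \<le> c) \<and> even c)"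

text \<open>A play that reaches a dead end is lost by the owner of that position.\<close>

definition eve_wins :: "('v, 'b) parity_game_scheme \<Rightarrow> 'v \<Rightarrow> bool" where
  "eve_wins G v \<longleftrightarrow>
     (\<exists>\<sigma>. eve_strategy G v \<sigma> \<and>
        (\<forall>h. finite_play G v h \<and> finite_conform G \<sigma> h \<and> dead_end G (last h)
           \<longrightarrow> last h \<notin> eve_pos G) \<and>
        (\<forall>p. infinite_play G v p \<and> infinite_conform G \<sigma> p \<longrightarrow> parity_condition G p))"

section \<open>Collapsible alternating pushdown tree automata\<close>

datatype 'a pbf = PTrue | PFalse | Atom 'a | Conj "'a pbf" "'a pbf" | Disj "'a pbf" "'a pbf"

text \<open>The transition function also reads the bottom symbol \<open>None\<close>.\<close>

record ('ap, 'd, 'g, 'q) capta =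
  stack_alphabet :: "'g set"
  states :: "'q set"
  trans :: "'q \<Rightarrow> 'ap set \<Rightarrow> 'g option \<Rightarrow> ('d \<times> 'q \<times> 'g stack_op) pbf"
  init_state :: 'q
  colour :: "'q \<Rightarrow> nat"

definition is_capta :: "nat \<Rightarrow> 'ap set \<Rightarrow> 'd set \<Rightarrow> ('ap, 'd, 'g, 'q) capta \<Rightarrow> bool" where
  "is_capta k AP D A \<longleftrightarrow>
     k \<ge> 1 \<and> finite (stack_alphabet A) \<and> finite (states A) \<and> init_state A \<in> states A \<and>
     (\<forall>q\<in>states A. \<forall>a\<subseteq>AP. \<forall>\<gamma>\<in>insert None (Some ` stack_alphabet A).
        set_pbf (trans A q a \<gamma>) \<subseteq> D \<times> states A \<times> stack_ops k (stack_alphabet A))"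

type_synonym ('d, 'g, 'q) acc_pos =
  "'d list \<times> 'q \<times> 'g stack \<times> ('d \<times> 'q \<times> 'g stack_op) pbf"

inductive acc_move ::
    "nat \<Rightarrow> ('ap, 'd, 'g, 'q) capta \<Rightarrow> ('ap, 'd) ltree \<Rightarrow>
     ('d, 'g, 'q) acc_pos \<Rightarrow> ('d, 'g, 'q) acc_pos \<Rightarrow> bool"
  for k A T where
  "acc_move k A T (v, q, s, Disj \<phi> \<psi>) (v, q, s, \<phi>)"
| "acc_move k A T (v, q, s, Disj \<phi> \<psi>) (v, q, s, \<psi>)"
| "acc_move k A T (v, q, s, Conj \<phi> \<psi>) (v, q, s, \<phi>)"
| "acc_move k A T (v, q, s, Conj \<phi> \<psi>) (v, q, s, \<psi>)"
| "\<lbrakk> v @ [x] \<in> fst T; apply_op k oper s = Some s' \<rbrakk> \<Longrightarrow>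
   acc_move k A T (v, q, s, Atom (x, q', oper))
     (v @ [x], q', s', trans A q' (snd T (v @ [x])) (top_symbol k s'))"

text \<open>
  Dead ends are the positions with formula \<open>PTrue\<close>, owned by Adam and hence won by Eve, and those
  with formula \<open>PFalse\<close>, owned by Eve and hence won by Adam. Atoms are owned by Eve as well, so
  she loses at an atom whose child does not exist or whose stack operation is undefined.
\<close>

primrec eve_formula :: "'a pbf \<Rightarrow> bool" where
  "eve_formula PTrue = False"
| "eve_formula PFalse = True"
| "eve_formula (Atom a) = True"
| "eve_formula (Conj \<phi> \<psi>) = False"
| "eve_formula (Disj \<phi> \<psi>) = True"

definition acc_game ::
    "nat \<Rightarrow> ('ap, 'd, 'g, 'q) capta \<Rightarrow> ('ap, 'd) ltree \<Rightarrow> ('d, 'g, 'q) acc_pos parity_game" where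
  "acc_game k A T =
     \<lparr> eve_pos = {(v, q, s, \<phi>). eve_formula \<phi>},
       moves = {(m, m'). acc_move k A T m m'},
       pos_colour = (\<lambda>(v, q, s, \<phi>). colour A q) \<rparr>"

definition acc_init ::
    "nat \<Rightarrow> ('ap, 'd, 'g, 'q) capta \<Rightarrow> ('ap, 'd) ltree \<Rightarrow> 'd list \<Rightarrow> 'g stack \<Rightarrow>
     ('d, 'g, 'q) acc_pos" where
  "acc_init k A T u w =
     (u, init_state A, w, trans A (init_state A) (snd T u) (top_symbol k w))"

definition Lang ::
    "nat \<Rightarrow> 'ap set \<Rightarrow> 'd set \<Rightarrow> ('ap, 'd, 'g, 'q) capta \<Rightarrow> 'g stack \<Rightarrow>
     (('ap, 'd) ltree \<times> 'd list) set" where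
  "Lang k AP D A w =
     {(T, u). is_pointed_tree AP D T u \<and> eve_wins (acc_game k A T) (acc_init k A T u w)}"

end

(*
  The widening forgets nothing but the Y-components of the directions, which occur neither in its
  labelling nor, beyond membership in X and Y, in its shape. Erasing these components from the atoms
  of the transition formulas therefore gives an automaton whose acceptance game on T is bisimilar to
  the acceptance game of A on the widening, via projection of the current node. The existence of a
  winning strategy for Eve is invariant under bisimilarity.
*)
theory Submission
  imports Defs
begin

section \<open>Parity games and bisimulation\<close>

lemma finite_play_single [simp]: "finite_play G v [x] \<longleftrightarrow> x = v"
  by (auto simp: finite_play_def)

lemma finite_play_snoc:
  assumes "h \<noteq> []"
  shows "finite_play G v (h @ [x]) \<longleftrightarrow> finite_play G v h \<and> (last h, x) \<in> moves G"
proof -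
  have "(\<forall>i. Suc i < length (h @ [x]) \<longrightarrow> ((h @ [x]) ! i, (h @ [x]) ! Suc i) \<in> moves G) \<longleftrightarrow>
      (\<forall>i. Suc i < length h \<longrightarrow> (h ! i, h ! Suc i) \<in> moves G) \<and> (last h, x) \<in> moves G"
    (is "?L \<longleftrightarrow> ?R")
  proof
    assume L: ?L
    have "(h ! i, h ! Suc i) \<in> moves G" if "Suc i < length h" for i
      using L[rule_format, of i] that by (simp add: nth_append)
    moreover have "(last h, x) \<in> moves G"
      using L[rule_format, of "length h - 1"] assms by (simp add: nth_append last_conv_nth)
    ultimately show ?R by blast
  next
    assume R: ?R
    show ?L
    proof (intro allI impI)
      fix i assume i: "Suc i < length (h @ [x])"
      show "((h @ [x]) ! i, (h @ [x]) ! Suc i) \<in> moves G"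
      proof (cases "Suc i < length h")
        case True
        then show ?thesis using R by (simp add: nth_append)
      next
        case False
        with i have "length h = Suc i" by simp
        then show ?thesis using R assms by (simp add: nth_append last_conv_nth)
      qed
    qed
  qed
  then show ?thesis using assms by (simp add: finite_play_def)
qed

lemma finite_conform_single [simp]: "finite_conform G \<sigma> [x]"
  by (simp add: finite_conform_def)

lemma finite_conform_snoc:
  assumes "h \<noteq> []"
  shows "finite_conform G \<sigma> (h @ [x]) \<longleftrightarrow>
    finite_conform G \<sigma> h \<and> (last h \<in> eve_pos G \<longrightarrow> x = \<sigma> h)" (is "?L \<longleftrightarrow> ?R")
proof
  assume L: ?L
  have "h ! Suc i = \<sigma> (take (Suc i) h)" if "Suc i < length h" "h ! i \<in> eve_pos G" for i
    using L[unfolded finite_conform_def, rule_format, of i] that by (simp add: nth_append)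
  moreover have "x = \<sigma> h" if "last h \<in> eve_pos G"
    using L[unfolded finite_conform_def, rule_format, of "length h - 1"] assms that
    by (simp add: nth_append last_conv_nth)
  ultimately show ?R unfolding finite_conform_def by blast
next
  assume R: ?R
  show ?L
    unfolding finite_conform_def
  proof (intro allI impI)
    fix i assume i: "Suc i < length (h @ [x]) \<and> (h @ [x]) ! i \<in> eve_pos G"
    show "(h @ [x]) ! Suc i = \<sigma> (take (Suc i) (h @ [x]))"
    proof (cases "Suc i < length h")
      case True
      then show ?thesis using R i by (simp add: nth_append finite_conform_def)
    next
      case False
      with i have "length h = Suc i" by simp
      then show ?thesis using R i assms by (simp add: nth_append last_conv_nth)
    qed
  qed
qed

text \<open>Eve plays in \<open>H\<close> while keeping a shadow play in \<open>G\<close> that stays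
  related position by position and follows her winning strategy there. Strategies read the whole
  history, so the shadow can be recomputed from it at each turn.\<close>

lemma eve_wins_bisim:
  fixes G :: "('v, 'b) parity_game_scheme" and H :: "('w, 'c) parity_game_scheme"
  assumes R: "R v w"
    and eve: "\<And>v w. R v w \<Longrightarrow> v \<in> eve_pos G \<longleftrightarrow> w \<in> eve_pos H"
    and colour: "\<And>v w. R v w \<Longrightarrow> pos_colour G v = pos_colour H w"
    and forward: "\<And>v w v'. R v w \<Longrightarrow> (v, v') \<in> moves G \<Longrightarrow> \<exists>w'. (w, w') \<in> moves H \<and> R v' w'"
    and backward: "\<And>v w w'. R v w \<Longrightarrow> (w, w') \<in> moves H \<Longrightarrow> \<exists>v'. (v, v') \<in> moves G \<and> R v' w'"
    and win: "eve_wins G v"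
  shows "eve_wins H w"
proof -
  obtain \<sigma> where \<sigma>: "eve_strategy G v \<sigma>"
    and fin: "\<And>h. finite_play G v h \<Longrightarrow> finite_conform G \<sigma> h \<Longrightarrow> dead_end G (last h) \<Longrightarrow>
      last h \<notin> eve_pos G"
    and inf: "\<And>p. infinite_play G v p \<Longrightarrow> infinite_conform G \<sigma> p \<Longrightarrow> parity_condition G p"
    using win unfolding eve_wins_def by blast
  \<comment> \<open>This takes both transfer directions: a move available on either side would
    produce one on the other.\<close>
  have dead: "dead_end G a \<longleftrightarrow> dead_end H b" if "R a b" for a b
    using forward[OF that] backward[OF that] unfolding dead_end_def by blast
  have \<sigma>_move: "(last g, \<sigma> g) \<in> moves G"
    if "finite_play G v g" "last g \<in> eve_pos G" "\<not> dead_end G (last g)" for g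
    using \<sigma> that unfolding eve_strategy_def by blast
  \<comment> \<open>\<open>R\<close> need not be functional, so a move to \<open>w'\<close> may have
    several matches. The choice of \<open>\<sigma>\<close> is preferred whenever it is one of them;
    this keeps the shadow conforming to \<open>\<sigma>\<close>. Otherwise any matching move
    serves.\<close>
  define step where "step g w' = (if last g \<in> eve_pos G \<and> R (\<sigma> g) w' then \<sigma> g
      else SOME v'. (last g, v') \<in> moves G \<and> R v' w')" for g w'
  \<comment> \<open>The shadow always starts at \<open>v\<close>, whatever the head of
    \<open>h\<close> is; the fold only consumes the later positions.\<close>
  define lift where "lift h = foldl (\<lambda>g w'. g @ [step g w']) [v] (tl h)" for h
  define \<tau> where "\<tau> h = (SOME w'. (last h, w') \<in> moves H \<and> R (\<sigma> (lift h)) w')" for h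
  have lift_single [simp]: "lift [x] = [v]" for x
    by (simp add: lift_def)
  have lift_snoc: "lift (h @ [x]) = lift h @ [step (lift h) x]" if "h \<noteq> []" for h x
    using that by (simp add: lift_def)
  have lift_ne [simp]: "lift h \<noteq> []" for h
    by (cases "tl h" rule: rev_cases) (simp_all add: lift_def)
  \<comment> \<open>Proved for all plays in \<open>H\<close>, including those deviating from
    \<open>\<tau>\<close>, since \<open>eve_strategy\<close> demands legal answers after every
    play.\<close>
  have lift_play: "finite_play G v (lift h) \<and> R (last (lift h)) (last h)"
    if "finite_play H w h" for h
  proof -
    have "h \<noteq> []" using that by (simp add: finite_play_def)
    then show ?thesis using that
    proof (induction h rule: rev_nonempty_induct)
      case (single x)
      then show ?case using R by simp
    next
      case (snoc x h)
      then have h: "finite_play H w h" and mv: "(last h, x) \<in> moves H"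
        by (simp_all add: finite_play_snoc)
      have IH: "finite_play G v (lift h)" "R (last (lift h)) (last h)"
        using snoc.IH[OF h] by simp_all
      have ex: "\<exists>v'. (last (lift h), v') \<in> moves G \<and> R v' x"
        using backward[OF IH(2) mv] .
      then have nd: "\<not> dead_end G (last (lift h))"
        by (auto simp: dead_end_def)
      have "(last (lift h), step (lift h) x) \<in> moves G \<and> R (step (lift h) x) x"
      proof (cases "last (lift h) \<in> eve_pos G \<and> R (\<sigma> (lift h)) x")
        case True
        then show ?thesis using \<sigma>_move[OF IH(1) _ nd] by (simp add: step_def)
      next
        case False
        then show ?thesis using someI_ex[OF ex] unfolding step_def by auto
      qed
      then show ?case
        using IH(1) snoc.hyps by (simp add: lift_snoc finite_play_snoc)
    qed
  qed
  have \<tau>_move: "(last h, \<tau> h) \<in> moves H \<and> R (\<sigma> (lift h)) (\<tau> h)"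
    if h: "finite_play H w h" and e: "last h \<in> eve_pos H" and nd: "\<not> dead_end H (last h)" for h
  proof -
    note l = lift_play[OF h]
    have "(last (lift h), \<sigma> (lift h)) \<in> moves G"
      using \<sigma>_move l eve dead e nd by blast
    then have "\<exists>w'. (last h, w') \<in> moves H \<and> R (\<sigma> (lift h)) w'"
      using forward l by blast
    from someI_ex[OF this] show ?thesis unfolding \<tau>_def .
  qed
  \<comment> \<open>If Eve moved by \<open>\<tau>\<close>, the new position is related to the choice
    of \<open>\<sigma>\<close> on the shadow, so the test in \<open>step\<close> succeeds and the
    shadow makes exactly that choice.\<close>
  have lift_conform: "finite_conform G \<sigma> (lift h)"
    if "finite_play H w h" "finite_conform H \<tau> h" for h
  proof -
    have "h \<noteq> []" using that by (simp add: finite_play_def)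
    then show ?thesis using that
    proof (induction h rule: rev_nonempty_induct)
      case (single x)
      then show ?case by simp
    next
      case (snoc x h)
      then have h: "finite_play H w h" and mv: "(last h, x) \<in> moves H"
        and c: "finite_conform H \<tau> h" and x: "last h \<in> eve_pos H \<Longrightarrow> x = \<tau> h"
        by (simp_all add: finite_play_snoc finite_conform_snoc)
      have nd: "\<not> dead_end H (last h)" using mv by (auto simp: dead_end_def)
      have "step (lift h) x = \<sigma> (lift h)" if "last (lift h) \<in> eve_pos G"
      proof -
        have e: "last h \<in> eve_pos H" using that eve lift_play[OF h] by blast
        then have "R (\<sigma> (lift h)) x" using \<tau>_move[OF h e nd] x by simp
        then show ?thesis using that by (simp add: step_def)
      qed
      then show ?case
        using snoc.IH[OF h c] snoc.hyps by (simp add: lift_snoc finite_conform_snoc)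
    qed
  qed
  have "eve_strategy H w \<tau>"
    using \<tau>_move unfolding eve_strategy_def by blast
  moreover have "last h \<notin> eve_pos H"
    if "finite_play H w h" "finite_conform H \<tau> h" "dead_end H (last h)" for h
    using fin lift_play lift_conform that dead eve by blast
  moreover have "parity_condition H p"
    if p: "infinite_play H w p" and c: "infinite_conform H \<tau> p" for p
  proof -
    \<comment> \<open>The limit of the shadows: its \<open>n\<close>-th entry ends the shadow of the
      prefix with \<open>n + 1\<close> positions.\<close>
    define q where "q n = last (lift (map p [0..<Suc n]))" for n
    have play: "finite_play H w (map p [0..<Suc n]) \<and> finite_conform H \<tau> (map p [0..<Suc n])" for n
    proof (induction n)
      case 0
      then show ?case using p by (simp add: infinite_play_def)
    next
      case (Suc n)
      have "map p [0..<Suc (Suc n)] = map p [0..<Suc n] @ [p (Suc n)]" by simp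
      moreover have "last (map p [0..<Suc n]) = p n" "map p [0..<Suc n] \<noteq> []" by simp_all
      ultimately show ?case
        using Suc p c unfolding infinite_play_def infinite_conform_def
        by (metis finite_play_snoc finite_conform_snoc)
    qed
    have rel: "R (q n) (p n)" for n
      using lift_play[of "map p [0..<Suc n]"] play[of n] by (simp add: q_def)
    \<comment> \<open>Shadows of longer prefixes extend those of shorter ones, so \<open>q\<close>
      is a single play rather than a sequence of unrelated endpoints.\<close>
    have lift_p: "lift (map p [0..<Suc n]) = map q [0..<Suc n]" for n
    proof (induction n)
      case 0
      then show ?case by (simp add: q_def)
    next
      case (Suc n)
      have "map p [0..<Suc (Suc n)] = map p [0..<Suc n] @ [p (Suc n)]" by simp
      then have "lift (map p [0..<Suc (Suc n)]) = lift (map p [0..<Suc n]) @ [q (Suc n)]"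
        unfolding q_def by (metis lift_snoc last_snoc Nil_is_map_conv upt_eq_Nil_conv
            zero_less_Suc not_le nat.distinct(1))
      then show ?case using Suc by simp
    qed
    \<comment> \<open>Both facts are read off the last move of the shadow of the prefix with
      \<open>n + 2\<close> positions.\<close>
    have snoc: "(q n, q (Suc n)) \<in> moves G"
      "q n \<in> eve_pos G \<Longrightarrow> q (Suc n) = \<sigma> (map q [0..<Suc n])" for n
    proof -
      have eq: "lift (map p [0..<Suc (Suc n)]) = map q [0..<Suc n] @ [q (Suc n)]"
        unfolding lift_p by simp
      have ne: "map q [0..<Suc n] \<noteq> []" and la: "last (map q [0..<Suc n]) = q n" by simp_all
      have "finite_play G v (map q [0..<Suc n] @ [q (Suc n)])"
        using lift_play play[of "Suc n"] eq by metis
      then show "(q n, q (Suc n)) \<in> moves G"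
        unfolding finite_play_snoc[OF ne] la by blast
      have "finite_conform G \<sigma> (map q [0..<Suc n] @ [q (Suc n)])"
        using lift_conform play[of "Suc n"] eq by metis
      then show "q n \<in> eve_pos G \<Longrightarrow> q (Suc n) = \<sigma> (map q [0..<Suc n])"
        unfolding finite_conform_snoc[OF ne] la by blast
    qed
    have "q 0 = v" by (simp add: q_def)
    then have "parity_condition G q"
      using inf snoc unfolding infinite_play_def infinite_conform_def by blast
    \<comment> \<open>Related positions have equal colours at every index, so the two plays have the
      same colour sequence.\<close>
    then show ?thesis
      unfolding parity_condition_def using colour[OF rel] by simp
  qed
  ultimately show ?thesis unfolding eve_wins_def by blast
qed

section \<open>Stack symbols\<close>

text \<open>Nonemptiness matters because \<^const>\<open>last\<close> is unspecified on the empty list.\<close>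

inductive stack_over :: "'g set \<Rightarrow> 'g stack \<Rightarrow> bool" for \<Gamma> where
  Letter: "set_letter a \<subseteq> \<Gamma> \<Longrightarrow> stack_over \<Gamma> (Letter a)"
| Seq: "ss \<noteq> [] \<Longrightarrow> (\<And>s. s \<in> set ss \<Longrightarrow> stack_over \<Gamma> s) \<Longrightarrow> stack_over \<Gamma> (Seq ss)"

lemma stack_over_Letter [simp]: "stack_over \<Gamma> (Letter a) \<longleftrightarrow> set_letter a \<subseteq> \<Gamma>"
  by (auto intro: stack_over.Letter elim: stack_over.cases)

lemma stack_over_Seq [simp]:
  "stack_over \<Gamma> (Seq ss) \<longleftrightarrow> ss \<noteq> [] \<and> (\<forall>s\<in>set ss. stack_over \<Gamma> s)"
  by (auto intro: stack_over.Seq elim: stack_over.cases)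

text \<open>Forgets orders and links, keeping only what the transition function can depend on: the
  symbols that occur and the nonemptiness of all sequences.\<close>

lemma stacks_of_order_over: "s \<in> stacks_of_order \<Gamma> k j \<Longrightarrow> stack_over \<Gamma> s"
proof (induction \<Gamma> k j arbitrary: s rule: stacks_of_order.induct)
  case (2 \<Gamma> k)
  have "set_letter a \<subseteq> \<Gamma>" if "a \<in> letters \<Gamma> k" for a
    using that by (auto simp: letters_def)
  with 2 show ?case by (auto simp: in_lists_conv_set)
next
  case (3 \<Gamma> k j)
  then show ?case by (auto simp: in_lists_conv_set)
qed simp

lemma stack_over_top_at: "stack_over \<Gamma> s \<Longrightarrow> stack_over \<Gamma> (top_at d s)"
  by (induction d arbitrary: s) (auto split: stack.split)

text \<open>Keeps the symbol that is read inside the range on which \<open>is_capta\<close>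
  constrains \<open>trans\<close>; the bottom letter accounts for \<open>None\<close>.\<close>

lemma top_symbol_over:
  assumes "stack_over \<Gamma> s"
  shows "top_symbol k s \<in> insert None (Some ` \<Gamma>)"
  using stack_over_top_at[OF assms, of k]
  by (auto simp: top_symbol_def top_letter_def split: stack.splits letter.splits)

text \<open>Reduces each stack operation to its local effect on one sequence. On the path to that
  sequence only last entries are replaced, so nothing becomes empty.\<close>

lemma stack_over_update_at:
  assumes "stack_over \<Gamma> s" and "update_at d f s = Some s'"
    and "\<And>ss ss'. stack_over \<Gamma> (Seq ss) \<Longrightarrow> f ss = Some ss' \<Longrightarrow> stack_over \<Gamma> (Seq ss')"
  shows "stack_over \<Gamma> s'"
  using assms(1,2)
proof (induction d arbitrary: s s')
  case 0
  then obtain ss ss' where s: "s = Seq ss" "s' = Seq ss'" "f ss = Some ss'"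
    by (auto split: stack.splits)
  then show ?case using assms(3)[of ss ss'] 0(1) by blast
next
  case (Suc d)
  then obtain ss t where "s = Seq ss" "update_at d f (last ss) = Some t" "s' = Seq (butlast ss @ [t])"
    by (auto split: stack.splits)
  then show ?case using Suc.IH[of "last ss" t] Suc.prems(1) by (auto dest: in_set_butlastD)
qed

text \<open>Pops and collapses keep a nonempty prefix, copies add nothing new, and
  \<open>stack_ops\<close> restricts pushed symbols to the alphabet. Thus the invariant survives
  along plays.\<close>

lemma stack_over_apply_op:
  assumes "stack_over \<Gamma> s" and "oper \<in> stack_ops k \<Gamma>" and "apply_op k oper s = Some s'"
  shows "stack_over \<Gamma> s'"
proof (cases oper)
  case (Pop i)
  \<comment> \<open>The guard on the length is exactly what leaves a nonempty sequence.\<close>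
  have "stack_over \<Gamma> (Seq (butlast ss))" if "stack_over \<Gamma> (Seq ss)" "2 \<le> length ss" for ss
  proof -
    have "length (butlast ss) \<noteq> 0" using that(2) by simp
    then have "butlast ss \<noteq> []" by blast
    then show ?thesis using that(1) by (simp add: in_set_butlastD)
  qed
  then show ?thesis
    by (intro stack_over_update_at[OF assms(1) assms(3)[unfolded Pop apply_op.simps]])
      (metis option.distinct(1) option.inject)
next
  case (Push i)
  show ?thesis
    using assms(3) unfolding Push apply_op.simps
    by (rule stack_over_update_at[OF assms(1)]) auto
next
  case (Push1 a)
  then have a: "a \<in> \<Gamma>" using assms(2) by (auto simp: stack_ops_def)
  show ?thesis
    using assms(3) unfolding Push1 apply_op.simps
    by (rule stack_over_update_at[OF assms(1)]) (use a in auto)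
next
  case (Push1Link a l)
  then have a: "a \<in> \<Gamma>" using assms(2) by (auto simp: stack_ops_def)
  show ?thesis
    using assms(3) unfolding Push1Link apply_op.simps
    by (rule stack_over_update_at[OF assms(1)]) (use a in auto)
next
  case Collapse
  then obtain a j h where "top_letter k s = Linked a j h"
    using assms(3) by (cases "top_letter k s") auto
  then have
    "update_at (k - j) (\<lambda>ss. if 0 < h \<and> h < length ss then Some (take h ss) else None) s = Some s'"
    using assms(3) Collapse by simp
  \<comment> \<open>Excluding the dangling value 0 makes the remaining prefix nonempty.\<close>
  moreover have "stack_over \<Gamma> (Seq (take h ss))"
    if "stack_over \<Gamma> (Seq ss)" "0 < h" for ss
    using that by (auto dest: in_set_takeD)
  ultimately show ?thesis
    by (elim stack_over_update_at[OF assms(1)]) (metis option.distinct(1) option.inject)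
qed

section \<open>Widening and projection\<close>

lemma proj_simps [simp]:
  "proj [] = []" "proj (a # v) = fst a # proj v" "proj (v @ v') = proj v @ proj v'"
  by (simp_all add: proj_def)

lemma proj_eq_Nil [simp]: "proj v = [] \<longleftrightarrow> v = []"
  by (simp add: proj_def)

text \<open>Since the root letter itself lies in \<open>X \<times> Y\<close>, the condition on the
  tail becomes one on the whole word, which is easier to extend by a child.\<close>

lemma in_widening:
  assumes "r \<in> X \<times> Y"
  shows "v \<in> fst (widening X Y r T) \<longleftrightarrow>
    v \<noteq> [] \<and> hd v = r \<and> v \<in> lists (X \<times> Y) \<and> proj v \<in> fst T"
  using assms by (cases v) (auto simp: widening_def)

text \<open>The tree axioms lift along the letterwise projection; the node \<open>v\<close>
  witnesses nonemptiness.\<close>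

lemma is_ltree_widening:
  assumes T: "is_ltree AP X T" and r: "r \<in> X \<times> Y" and v: "v \<in> fst (widening X Y r T)"
  shows "is_ltree AP (X \<times> Y) (widening X Y r T)"
proof -
  have tree: "is_tree X (fst T)" and lab: "\<And>u. u \<in> fst T \<Longrightarrow> snd T u \<subseteq> AP"
    using T by (auto simp: is_ltree_def)
  have "\<exists>x. w @ [x] \<in> fst (widening X Y r T)" if w: "w \<in> fst (widening X Y r T)" for w
  proof -
    have "proj w \<in> fst T" using w in_widening[OF r] by blast
    then obtain x where x: "proj w @ [x] \<in> fst T"
      using tree unfolding is_tree_def by blast
    moreover have "fst T \<subseteq> lists X" using tree unfolding is_tree_def by blast
    ultimately have "x \<in> X" by auto
    \<comment> \<open>A child of the projected node needs some second component in \<open>Y\<close>;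
      the root letter supplies one.\<close>
    then have "w @ [(x, snd r)] \<in> fst (widening X Y r T)"
      using w x r by (auto simp: in_widening[OF r] mem_Times_iff)
    then show ?thesis ..
  qed
  moreover have "w \<in> fst (widening X Y r T)"
    if "w @ w' \<in> fst (widening X Y r T)" "w \<noteq> []" for w w'
  proof -
    have "proj w \<in> fst T"
      using that tree unfolding is_tree_def in_widening[OF r] proj_simps by (metis proj_eq_Nil)
    then show ?thesis using that by (simp add: in_widening[OF r])
  qed
  moreover have "fst (widening X Y r T) \<noteq> {}" "[] \<notin> fst (widening X Y r T)"
    "fst (widening X Y r T) \<subseteq> lists (X \<times> Y)" "\<forall>w\<in>fst (widening X Y r T). hd w = r"
    using v in_widening[OF r] by blast+
  ultimately have "is_tree (X \<times> Y) (fst (widening X Y r T))"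
    unfolding is_tree_def by blast
  moreover have "snd (widening X Y r T) w \<subseteq> AP" if "w \<in> fst (widening X Y r T)" for w
    using that lab unfolding in_widening[OF r] by (simp add: widening_def)
  ultimately show ?thesis by (simp add: is_ltree_def)
qed

section \<open>The projected automaton\<close>

text \<open>The parameter \<open>f\<close> renames the states.\<close>

definition erase ::
    "('q \<Rightarrow> 'p) \<Rightarrow> (('x \<times> 'y) \<times> 'q \<times> 'o) pbf \<Rightarrow> ('x \<times> 'p \<times> 'o) pbf" where
  "erase f = map_pbf (\<lambda>(d, q, oper). (fst d, f q, oper))"

lemma erase_simps [simp]:
  "erase f PTrue = PTrue"
  "erase f PFalse = PFalse"
  "erase f (Atom (d, q, oper)) = Atom (fst d, f q, oper)"
  "erase f (Conj \<phi> \<psi>) = Conj (erase f \<phi>) (erase f \<psi>)"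
  "erase f (Disj \<phi> \<psi>) = Disj (erase f \<phi>) (erase f \<psi>)"
  by (simp_all add: erase_def)

lemma eve_formula_erase [simp]: "eve_formula (erase f \<phi>) = eve_formula \<phi>"
  by (cases \<phi>) (auto simp: erase_def)

lemma set_erase: "set_pbf (erase f \<phi>) = (\<lambda>(d, q, oper). (fst d, f q, oper)) ` set_pbf \<phi>"
  by (simp add: erase_def pbf.set_map)

text \<open>\<open>inv_into\<close> recovers the original state exactly when \<open>f\<close> is
  injective on the states; on values outside the image the result is arbitrary.\<close>

definition project_capta ::
    "('q \<Rightarrow> 'p) \<Rightarrow> ('ap, 'x \<times> 'y, 'g, 'q) capta \<Rightarrow> ('ap, 'x, 'g, 'p) capta" where
  "project_capta f A =
     \<lparr> stack_alphabet = stack_alphabet A, states = f ` states A,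
       trans = (\<lambda>p a \<gamma>. erase f (trans A (inv_into (states A) f p) a \<gamma>)),
       init_state = f (init_state A),
       colour = (\<lambda>p. colour A (inv_into (states A) f p)) \<rparr>"

lemma project_capta_simps [simp]:
  "stack_alphabet (project_capta f A) = stack_alphabet A"
  "states (project_capta f A) = f ` states A"
  "init_state (project_capta f A) = f (init_state A)"
  "inj_on f (states A) \<Longrightarrow> q \<in> states A \<Longrightarrow>
    trans (project_capta f A) (f q) a \<gamma> = erase f (trans A q a \<gamma>)"
  "inj_on f (states A) \<Longrightarrow> q \<in> states A \<Longrightarrow> colour (project_capta f A) (f q) = colour A q"
  by (simp_all add: project_capta_def)

text \<open>Re-establishes the constraint on formulas whenever an atom move loads a new transition
  formula.\<close>

lemma capta_trans_subset:
  assumes "is_capta k AP D A" "q \<in> states A" "a \<subseteq> AP" "stack_over (stack_alphabet A) s"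
  shows "set_pbf (trans A q a (top_symbol k s)) \<subseteq>
    D \<times> states A \<times> stack_ops k (stack_alphabet A)"
proof -
  have "\<forall>q\<in>states A. \<forall>a\<subseteq>AP. \<forall>\<gamma>\<in>insert None (Some ` stack_alphabet A).
      set_pbf (trans A q a \<gamma>) \<subseteq> D \<times> states A \<times> stack_ops k (stack_alphabet A)"
    using assms(1) unfolding is_capta_def by blast
  then show ?thesis using assms(2,3) top_symbol_over[OF assms(4), of k] by blast
qed

lemma is_capta_project:
  assumes A: "is_capta k AP (X \<times> Y) A" and f: "inj_on f (states A)"
  shows "is_capta k AP X (project_capta f A)"
proof -
  have "set_pbf (erase f (trans A q a \<gamma>)) \<subseteq> X \<times> f ` states A \<times> stack_ops k (stack_alphabet A)"
    if "q \<in> states A" "a \<subseteq> AP" "\<gamma> \<in> insert None (Some ` stack_alphabet A)" for q a \<gamma>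
  proof -
    have "set_pbf (trans A q a \<gamma>) \<subseteq> (X \<times> Y) \<times> states A \<times> stack_ops k (stack_alphabet A)"
      using A that unfolding is_capta_def by blast
    then show ?thesis unfolding set_erase by fastforce
  qed
  then show ?thesis
    using A f unfolding is_capta_def by simp
qed

section \<open>Bisimulation of the acceptance games\<close>

text \<open>
  All positions reachable from the initial one satisfy the constraints below; outside of them the
  transition function of the automaton is arbitrary.
\<close>

inductive projects ::
    "nat \<Rightarrow> ('ap, 'x \<times> 'y, 'g, 'q) capta \<Rightarrow> 'x set \<Rightarrow> 'y set \<Rightarrow> ('ap, 'x \<times> 'y) ltree \<Rightarrow> ('q \<Rightarrow> 'p) \<Rightarrow>
     ('x \<times> 'y, 'g, 'q) acc_pos \<Rightarrow> ('x, 'g, 'p) acc_pos \<Rightarrow> bool"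
  for k A X Y W f where
  "\<lbrakk> v \<in> fst W; q \<in> states A; stack_over (stack_alphabet A) s;
     set_pbf \<phi> \<subseteq> (X \<times> Y) \<times> states A \<times> stack_ops k (stack_alphabet A) \<rbrakk> \<Longrightarrow>
   projects k A X Y W f (v, q, s, \<phi>) (proj v, f q, s, erase f \<phi>)"

text \<open>An atom with direction \<open>d\<close> can be played in the widening just when
  \<open>fst d\<close> leads to a child in \<open>T\<close>. The label and the stack result are the
  same on both sides, so both transfer directions can share these facts.\<close>

lemma projects_atom:
  assumes A: "is_capta k AP (X \<times> Y) A" and T: "is_ltree AP X T" and f: "inj_on f (states A)"
    and r: "r \<in> X \<times> Y" and v: "v \<in> fst (widening X Y r T)"
    and s: "stack_over (stack_alphabet A) s"
    and atom: "(d, q', oper) \<in> (X \<times> Y) \<times> states A \<times> stack_ops k (stack_alphabet A)"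
    and child: "proj v @ [fst d] \<in> fst T"
    and ap: "apply_op k oper s = Some s'"
  shows "acc_move k A (widening X Y r T) (v, q, s, Atom (d, q', oper))
      (v @ [d], q', s', trans A q' (snd (widening X Y r T) (v @ [d])) (top_symbol k s'))" (is ?A)
    and "acc_move k (project_capta f A) T (proj v, f q, s, Atom (fst d, f q', oper))
      (proj v @ [fst d], f q', s',
       trans (project_capta f A) (f q') (snd T (proj v @ [fst d])) (top_symbol k s'))" (is ?B)
    and "projects k A X Y (widening X Y r T) f
      (v @ [d], q', s', trans A q' (snd (widening X Y r T) (v @ [d])) (top_symbol k s'))
      (proj v @ [fst d], f q', s',
       trans (project_capta f A) (f q') (snd T (proj v @ [fst d])) (top_symbol k s'))" (is ?C)
proof -
  have vd: "v @ [d] \<in> fst (widening X Y r T)"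
    using v atom child by (auto simp: in_widening[OF r])
  show ?A using vd ap by (rule acc_move.intros)
  show ?B using child ap by (rule acc_move.intros)
  have q': "q' \<in> states A" and op: "oper \<in> stack_ops k (stack_alphabet A)"
    using atom by auto
  have s': "stack_over (stack_alphabet A) s'"
    using stack_over_apply_op[OF s op ap] .
  have lab: "snd (widening X Y r T) (v @ [d]) = snd T (proj v @ [fst d])"
    by (simp add: widening_def)
  have "snd T (proj v @ [fst d]) \<subseteq> AP" using T child by (auto simp: is_ltree_def)
  from projects.intros[OF vd q' s' capta_trans_subset[OF A q' this s'], of f]
  show ?C using f q' lab by simp
qed

lemma projects_forth:
  assumes A: "is_capta k AP (X \<times> Y) A" and T: "is_ltree AP X T" and f: "inj_on f (states A)"
    and r: "r \<in> X \<times> Y" and rel: "projects k A X Y (widening X Y r T) f m n"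
    and mv: "acc_move k A (widening X Y r T) m m'"
  shows "\<exists>n'. acc_move k (project_capta f A) T n n' \<and> projects k A X Y (widening X Y r T) f m' n'"
  using rel
proof cases
  case (1 v q s \<phi>)
  \<comment> \<open>Covers the Boolean moves: they change only the formula, and a subformula has no
    new atoms.\<close>
  have keep: "projects k A X Y (widening X Y r T) f (v, q, s, \<psi>) (proj v, f q, s, erase f \<psi>)"
    if "set_pbf \<psi> \<subseteq> set_pbf \<phi>" for \<psi>
    using 1 that by (intro projects.intros) auto
  from mv show ?thesis
    unfolding 1(1)
  proof cases
    case (5 x oper s' q')
    then have child: "proj v @ [fst x] \<in> fst T" by (simp add: in_widening[OF r])
    have "(x, q', oper) \<in> (X \<times> Y) \<times> states A \<times> stack_ops k (stack_alphabet A)"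
      using 1(6) unfolding 5 by simp
    from projects_atom(2,3)[OF A T f r 1(3) 1(5) this child 5(4)]
    show ?thesis unfolding 1(2) 5 erase_simps by blast
  qed (use keep 1(2) in \<open>fastforce intro: acc_move.intros\<close>)+
qed

text \<open>A move in \<open>T\<close> names only an \<open>X\<close>-letter. The missing
  \<open>Y\<close>-letter is recovered from the unerased formula of the related position, whose atom
  fixes the full direction.\<close>

lemma projects_back:
  assumes A: "is_capta k AP (X \<times> Y) A" and T: "is_ltree AP X T" and f: "inj_on f (states A)"
    and r: "r \<in> X \<times> Y" and rel: "projects k A X Y (widening X Y r T) f m n"
    and mv: "acc_move k (project_capta f A) T n n'"
  shows "\<exists>m'. acc_move k A (widening X Y r T) m m' \<and> projects k A X Y (widening X Y r T) f m' n'"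
  using rel
proof cases
  case (1 v q s \<phi>)
  note mv' = mv[unfolded 1(2)]
  have keep: "projects k A X Y (widening X Y r T) f (v, q, s, \<psi>) (proj v, f q, s, erase f \<psi>)"
    if "set_pbf \<psi> \<subseteq> set_pbf \<phi>" for \<psi>
    using 1 that by (intro projects.intros) auto
  \<comment> \<open>The case split is on the unerased formula, because the erased atom no longer
    determines the direction to be played.\<close>
  show ?thesis
  proof (cases \<phi>)
    case PTrue
    with mv' show ?thesis by (auto elim: acc_move.cases)
  next
    case PFalse
    with mv' show ?thesis by (auto elim: acc_move.cases)
  next
    case (Atom a)
    obtain d q' oper where a: "a = (d, q', oper)" by (cases a)
    from mv' obtain s' where child: "proj v @ [fst d] \<in> fst T" and ap: "apply_op k oper s = Some s'"
      and n': "n' = (proj v @ [fst d], f q', s',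
        trans (project_capta f A) (f q') (snd T (proj v @ [fst d])) (top_symbol k s'))"
      unfolding Atom a by (auto elim: acc_move.cases)
    have "(d, q', oper) \<in> (X \<times> Y) \<times> states A \<times> stack_ops k (stack_alphabet A)"
      using 1(6) unfolding Atom a by simp
    from projects_atom(1,3)[OF A T f r 1(3) 1(5) this child ap] show ?thesis
      unfolding 1(1) Atom a n' by blast
  next
    case (Conj \<phi>1 \<phi>2)
    with mv' consider "n' = (proj v, f q, s, erase f \<phi>1)" | "n' = (proj v, f q, s, erase f \<phi>2)"
      by (auto elim: acc_move.cases)
    then show ?thesis
      using keep[of \<phi>1] keep[of \<phi>2] Conj 1(1)
      by cases (fastforce intro: acc_move.intros)+
  next
    case (Disj \<phi>1 \<phi>2)
    with mv' consider "n' = (proj v, f q, s, erase f \<phi>1)" | "n' = (proj v, f q, s, erase f \<phi>2)"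
      by (auto elim: acc_move.cases)
    then show ?thesis
      using keep[of \<phi>1] keep[of \<phi>2] Disj 1(1)
      by cases (fastforce intro: acc_move.intros)+
  qed
qed

lemma eve_wins_project:
  assumes A: "is_capta k AP (X \<times> Y) A" and T: "is_ltree AP X T" and f: "inj_on f (states A)"
    and r: "r \<in> X \<times> Y" and u: "u \<in> fst (widening X Y r T)"
    and w: "stack_over (stack_alphabet A) w"
  shows "eve_wins (acc_game k (project_capta f A) T)
      (acc_init k (project_capta f A) T (proj u) w) \<longleftrightarrow>
    eve_wins (acc_game k A (widening X Y r T)) (acc_init k A (widening X Y r T) u w)"
    (is "eve_wins ?H ?n \<longleftrightarrow> eve_wins ?G ?m")
proof -
  let ?R = "projects k A X Y (widening X Y r T) f"
  have q: "init_state A \<in> states A" using A by (simp add: is_capta_def)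
  have lab: "snd (widening X Y r T) u = snd T (proj u)" by (simp add: widening_def)
  have "snd T (proj u) \<subseteq> AP" using T u by (auto simp: is_ltree_def in_widening[OF r])
  from projects.intros[OF u q w capta_trans_subset[OF A q this w], of f]
  have init: "?R ?m ?n" using f q lab by (simp add: acc_init_def)
  have eve: "m \<in> eve_pos ?G \<longleftrightarrow> n \<in> eve_pos ?H" if "?R m n" for m n
    using that by cases (simp add: acc_game_def)
  have col: "pos_colour ?G m = pos_colour ?H n" if "?R m n" for m n
    using that f by cases (simp add: acc_game_def)
  have forward: "\<exists>n'. (n, n') \<in> moves ?H \<and> ?R m' n'" if "?R m n" "(m, m') \<in> moves ?G" for m n m'
    using projects_forth[OF A T f r] that by (simp add: acc_game_def)
  have backward: "\<exists>m'. (m, m') \<in> moves ?G \<and> ?R m' n'" if "?R m n" "(n, n') \<in> moves ?H" for m n n'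
    using projects_back[OF A T f r] that by (simp add: acc_game_def)
  show ?thesis
  proof
    assume win: "eve_wins ?G ?m"
    show "eve_wins ?H ?n"
      by (rule eve_wins_bisim[where R = ?R and G = ?G and v = ?m])
        (use init eve col forward backward win in blast)+
  next
    assume win: "eve_wins ?H ?n"
    \<comment> \<open>The converse relation is a bisimulation too, with the two transfer properties
      exchanging roles.\<close>
    show "eve_wins ?G ?m"
      by (rule eve_wins_bisim[where R = "\<lambda>n m. ?R m n" and G = ?H and v = ?n])
        (use init eve col[symmetric] forward backward win in blast)+
  qed
qed

theorem theorem6p11:
  fixes k :: nat and AP :: "'ap set" and X :: "'x set" and Y :: "'y set"
    and A :: "('ap, 'x \<times> 'y, 'g, 'q) capta"
  assumes "is_capta k AP (X \<times> Y) A"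
  shows "\<exists>A' :: ('ap, 'x, 'g, nat) capta.
           is_capta k AP X A' \<and> stack_alphabet A' = stack_alphabet A \<and>
           (\<forall>T u u' w. is_pointed_tree AP X T u \<and>
              u' \<noteq> [] \<and> u' \<in> lists (X \<times> Y) \<and> proj u' = u \<and>
              w \<in> Stacks k (stack_alphabet A) \<longrightarrow>
              ((T, u) \<in> Lang k AP X A' w \<longleftrightarrow>
               (widening X Y (hd u') T, u') \<in> Lang k AP (X \<times> Y) A w))"
proof -
  have "finite (states A)" using assms by (simp add: is_capta_def)
  \<comment> \<open>The claim asks for natural numbers as states, so the finite state set is
    numbered injectively.\<close>
  then obtain f :: "'q \<Rightarrow> nat" where f: "inj_on f (states A)"
    using finite_imp_inj_to_nat_seg by blast
  show ?thesis
  proof (intro exI[of _ "project_capta f A"] conjI allI impI)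
    show "is_capta k AP X (project_capta f A)"
      using is_capta_project[OF assms f] .
    show "stack_alphabet (project_capta f A) = stack_alphabet A" by simp
    fix T :: "('ap, 'x) ltree" and u u' w
    assume asm: "is_pointed_tree AP X T u \<and> u' \<noteq> [] \<and> u' \<in> lists (X \<times> Y) \<and> proj u' = u \<and>
      w \<in> Stacks k (stack_alphabet A)"
    then have T: "is_ltree AP X T" and u: "proj u' = u" "u \<in> fst T"
      by (auto simp: is_pointed_tree_def)
    have r: "hd u' \<in> X \<times> Y" using asm by (metis hd_in_set in_listsD)
    have u': "u' \<in> fst (widening X Y (hd u') T)"
      using asm u in_widening[OF r] by blast
    have w: "stack_over (stack_alphabet A) w"
      using asm stacks_of_order_over unfolding Stacks_def by blast
    \<comment> \<open>\<open>Lang\<close> also demands a well-formed pointed tree; with this settled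
      on both sides, only the games remain to be compared.\<close>
    have "is_pointed_tree AP (X \<times> Y) (widening X Y (hd u') T) u'"
      using is_ltree_widening[OF T r u'] u' by (simp add: is_pointed_tree_def)
    then show "(T, u) \<in> Lang k AP X (project_capta f A) w \<longleftrightarrow>
        (widening X Y (hd u') T, u') \<in> Lang k AP (X \<times> Y) A w"
      using asm eve_wins_project[OF assms T f r u' w] by (simp add: Lang_def u(1))
  qed
qed

end
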